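(* Let $H=(V,E)$ be an unweighted multi-hypergraph with $n=|V|\ge 2$ and $E\neq\emptyset$, let $\eta>0$, and let $\langle\hat f,\hat\ell\rangle$ be a feasible solution to the system $\mathrm{Dual}(H,\eta)$. Let $\hat D=\max_{v\in V}\hat\ell(v)$ and $\varepsilon=\sqrt{8\eta\log n/\hat D}$, and suppose $\varepsilon\le 1$. Then $\rho^*(1-\varepsilon)\le \hat D(1-\varepsilon)<\rho^*$, where $\rho^*$ is the maximum density of $H$.
   Context: A multi-hypergraph $H=(V,E)$ has a multiset $E$ of hyperedges, each a nonempty subset of $V$ (distinct copies are distinct elements of $E$). For nonempty $U\subseteq V$, $E[U]$ is the multiset of hyperedges contained in $U$, the density is $\rho_H(U)=|E[U]|/|U|$, and $\rho^*=\max_U\rho_H(U)$. The system $\mathrm{Dual}(H,\eta)$ has variables $f_e(u)$ for $e\in E$, $u\in e$, and $\ell(v)$ for $v\in V$, subject to: $\ell(v)=\sum_{e\ni v}f_e(v)$ for all $v\in V$; $\sum_{u\in e}f_e(u)=1$ for all $e\in E$; $\ell(v)\le \ell(u)+\eta$ for all $e\in E$, all $v\in e$ with $f_e(v)>0$ and all $u\in e\setminus\{v\}$; and $f_e(u)\ge 0$ for all $e\in E$, $u\in e$. Here $\log$ is the natural logarithm. *)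

theory Defs
  imports Complex_Main
begin

text \<open>
  Hyperedges have identities of their own, and \<open>ends H\<close> maps each of them to its
  underlying vertex set. Parallel copies of a hyperedge are thus distinct elements of
  \<open>edges H\<close> with the same image under \<open>ends H\<close>, and \<open>card\<close> counts them with multiplicity.
\<close>

record ('v, 'e) hypergraph =
  verts :: "'v set"
  edges :: "'e set"
  ends :: "'e \<Rightarrow> 'v set"

definition multi_hypergraph :: "('v, 'e) hypergraph \<Rightarrow> bool" where
  "multi_hypergraph H \<longleftrightarrow>
     finite (verts H) \<and> finite (edges H) \<and>
     (\<forall>e \<in> edges H. ends H e \<noteq> {} \<and> ends H e \<subseteq> verts H)"

definition induced_edges :: "('v, 'e) hypergraph \<Rightarrow> 'v set \<Rightarrow> 'e set" where
  "induced_edges H U = {e \<in> edges H. ends H e \<subseteq> U}"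

definition density :: "('v, 'e) hypergraph \<Rightarrow> 'v set \<Rightarrow> real" where
  "density H U = real (card (induced_edges H U)) / real (card U)"

definition max_density :: "('v, 'e) hypergraph \<Rightarrow> real" where
  "max_density H = Max (density H ` {U. U \<subseteq> verts H \<and> U \<noteq> {}})"

text \<open>
  The values \<open>f e u\<close> for \<open>e \<notin> edges H\<close> or \<open>u \<notin> ends H e\<close>, and \<open>l v\<close> for \<open>v \<notin> verts H\<close>,
  are not variables of the system; they are left unconstrained and are never used.
\<close>

definition dual_feasible ::
  "('v, 'e) hypergraph \<Rightarrow> real \<Rightarrow> ('e \<Rightarrow> 'v \<Rightarrow> real) \<Rightarrow> ('v \<Rightarrow> real) \<Rightarrow> bool" where
  "dual_feasible H \<eta> f l \<longleftrightarrow>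
     (\<forall>v \<in> verts H. l v = (\<Sum>e \<in> {e \<in> edges H. v \<in> ends H e}. f e v)) \<and>
     (\<forall>e \<in> edges H. (\<Sum>u \<in> ends H e. f e u) = 1) \<and>
     (\<forall>e \<in> edges H. \<forall>v \<in> ends H e. f e v > 0 \<longrightarrow>
        (\<forall>u \<in> ends H e - {v}. l v \<le> l u + \<eta>)) \<and>
     (\<forall>e \<in> edges H. \<forall>u \<in> ends H e. f e u \<ge> 0)"

end

theory Submission
  imports Defs
begin

text \<open>
  For the upper bound on \<open>D\<close>, consider the level sets \<open>T\<^sub>i = {v. l v \<ge> D - i * \<eta>}\<close>. A hyperedge that
  sends positive weight to a vertex of \<open>T\<^sub>i\<close> lies inside \<open>T\<^sub>i\<^sub>+\<^sub>1\<close>, so the total load of \<open>T\<^sub>i\<close> is at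
  most the number of hyperedges inside \<open>T\<^sub>i\<^sub>+\<^sub>1\<close>, whence \<open>(D - i * \<eta>) * |T\<^sub>i| \<le> \<rho>\<^sup>* * |T\<^sub>i\<^sub>+\<^sub>1|\<close>. If
  \<open>\<rho>\<^sup>* \<le> D * (1 - \<epsilon>)\<close>, then as long as \<open>i * \<eta> \<le> \<epsilon> * D / 2\<close> the level sets grow by a factor of at
  least \<open>exp (\<epsilon> / 2)\<close> per step; this lasts for more than \<open>4 * ln n / \<epsilon>\<close> steps, and the last level
  set would have more than \<open>n\<close> vertices.
\<close>

section \<open>Bounds on the maximum density\<close>

text \<open>Multiplied out, the density bound also covers \<open>U = {}\<close>: hyperedges are
  nonempty, so none lies inside the empty set.\<close>

lemma card_induced_edges_le_max_density:
  assumes "multi_hypergraph H" and "U \<subseteq> verts H"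
  shows "real (card (induced_edges H U)) \<le> max_density H * real (card U)"
proof (cases "U = {}")
  case True
  then have "induced_edges H U = {}"
    using assms(1) by (auto simp: induced_edges_def multi_hypergraph_def)
  with True show ?thesis by simp
next
  case False
  have fin: "finite (verts H)"
    using assms(1) by (simp add: multi_hypergraph_def)
  have "density H U \<le> max_density H"
    unfolding max_density_def
    by (rule Max_ge) (use fin assms(2) False in auto)
  moreover have "card U > 0"
    using False finite_subset[OF assms(2) fin] by (simp add: card_gt_0_iff)
  ultimately show ?thesis
    by (simp add: density_def divide_le_eq)
qed

lemma max_density_le:
  assumes "multi_hypergraph H" and "verts H \<noteq> {}"
    and "\<And>U. U \<subseteq> verts H \<Longrightarrow> real (card (induced_edges H U)) \<le> c * real (card U)"
  shows "max_density H \<le> c"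
proof -
  have fin: "finite (verts H)"
    using assms(1) by (simp add: multi_hypergraph_def)
  have "density H U \<le> c" if "U \<subseteq> verts H" "U \<noteq> {}" for U
  proof -
    have "card U > 0"
      using that finite_subset[OF that(1) fin] by (simp add: card_gt_0_iff)
    then show ?thesis
      using assms(3)[OF that(1)] by (simp add: density_def divide_le_eq)
  qed
  moreover have "finite {U. U \<subseteq> verts H \<and> U \<noteq> {}}"
    using fin by simp
  moreover have "{U. U \<subseteq> verts H \<and> U \<noteq> {}} \<noteq> {}"
    using assms(2) by blast
  ultimately show ?thesis
    unfolding max_density_def by (subst Max_le_iff) auto
qed

lemma max_density_pos:
  assumes "multi_hypergraph H" and "edges H \<noteq> {}"
  shows "max_density H > 0"
proof -
  have "induced_edges H (verts H) = edges H"
    using assms(1) by (auto simp: induced_edges_def multi_hypergraph_def)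
  then have "real (card (edges H)) \<le> max_density H * real (card (verts H))"
    using card_induced_edges_le_max_density[OF assms(1) order_refl] by simp
  moreover have "card (edges H) > 0"
    using assms by (simp add: multi_hypergraph_def card_gt_0_iff)
  ultimately have "0 < max_density H * real (card (verts H))"
    by linarith
  then show ?thesis
    by (simp add: zero_less_mult_iff)
qed

section \<open>Loads against induced hyperedges\<close>

text \<open>Double counting: swapping the sums lets the total load be estimated one hyperedge at a
  time.\<close>

lemma sum_load_eq:
  assumes "multi_hypergraph H" and "dual_feasible H \<eta> f l" and "U \<subseteq> verts H"
  shows "(\<Sum>v\<in>U. l v) = (\<Sum>e\<in>edges H. \<Sum>v\<in>{v \<in> U. v \<in> ends H e}. f e v)"
proof -
  have fin: "finite U" "finite (edges H)"
    using assms(1,3) finite_subset by (auto simp: multi_hypergraph_def)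
  have "(\<Sum>v\<in>U. l v) = (\<Sum>v\<in>U. \<Sum>e\<in>{e \<in> edges H. v \<in> ends H e}. f e v)"
    using assms(2,3) by (intro sum.cong) (auto simp: dual_feasible_def)
  also have "\<dots> = (\<Sum>e\<in>edges H. \<Sum>v\<in>{v \<in> U. v \<in> ends H e}. f e v)"
    by (rule sum.swap_restrict[OF fin])
  finally show ?thesis .
qed

text \<open>A hyperedge inside \<open>U\<close> spends its whole unit of weight in \<open>U\<close>;
  every other hyperedge contributes a nonnegative amount.\<close>

lemma card_induced_edges_le_sum_load:
  assumes "multi_hypergraph H" and "dual_feasible H \<eta> f l" and "U \<subseteq> verts H"
  shows "real (card (induced_edges H U)) \<le> (\<Sum>v\<in>U. l v)"
proof -
  have "real (card (induced_edges H U)) =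
      (\<Sum>e\<in>induced_edges H U. \<Sum>v\<in>{v \<in> U. v \<in> ends H e}. f e v)"
  proof -
    have "(\<Sum>v\<in>{v \<in> U. v \<in> ends H e}. f e v) = 1" if "e \<in> induced_edges H U" for e
    proof -
      have "{v \<in> U. v \<in> ends H e} = ends H e"
        using that by (auto simp: induced_edges_def)
      then show ?thesis
        using that assms(2) by (simp add: induced_edges_def dual_feasible_def)
    qed
    then show ?thesis by simp
  qed
  also have "\<dots> \<le> (\<Sum>e\<in>edges H. \<Sum>v\<in>{v \<in> U. v \<in> ends H e}. f e v)"
    using assms(1,2)
    by (intro sum_mono2 sum_nonneg)
       (auto simp: multi_hypergraph_def induced_edges_def dual_feasible_def)
  finally show ?thesis
    using sum_load_eq[OF assms] by simp
qed

section \<open>Level sets and their growth\<close>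

definition level_set :: "('v, 'e) hypergraph \<Rightarrow> ('v \<Rightarrow> real) \<Rightarrow> real \<Rightarrow> 'v set" where
  "level_set H l a = {v \<in> verts H. a \<le> l v}"

lemma level_set_subset: "level_set H l a \<subseteq> verts H"
  by (auto simp: level_set_def)

text \<open>A hyperedge not inside the lower level set sends nothing to the upper one, and any other
  sends at most its unit of weight.\<close>

lemma sum_load_level_set_le:
  assumes "multi_hypergraph H" and "dual_feasible H \<eta> f l" and "\<eta> \<ge> 0"
  shows "(\<Sum>v\<in>level_set H l a. l v) \<le> real (card (induced_edges H (level_set H l (a - \<eta>))))"
proof -
  let ?U = "level_set H l a" and ?W = "level_set H l (a - \<eta>)"
  let ?g = "\<lambda>e. \<Sum>v\<in>{v \<in> ?U. v \<in> ends H e}. f e v"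
  have fin: "finite (edges H)" "finite (verts H)"
    using assms(1) by (auto simp: multi_hypergraph_def)
  have outside: "?g e = 0" if e: "e \<in> edges H" "e \<notin> induced_edges H ?W" for e
  proof (rule sum.neutral, rule ballI, rule ccontr)
    fix v assume v: "v \<in> {v \<in> ?U. v \<in> ends H e}" and "f e v \<noteq> 0"
    then have "f e v > 0"
      using e assms(2) by (force simp: dual_feasible_def)
    \<comment> \<open>The system compares \<open>v\<close> only with the other vertices of
      \<open>e\<close>; for \<open>u = v\<close> the inequality is
      \<open>\<eta> \<ge> 0\<close>.\<close>
    then have "l v \<le> l u + \<eta>" if "u \<in> ends H e" for u
      using that e v assms(2,3) by (cases "u = v") (auto simp: dual_feasible_def)
    then have "ends H e \<subseteq> ?W"
      using v e assms(1) by (fastforce simp: level_set_def multi_hypergraph_def)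
    with e show False by (simp add: induced_edges_def)
  qed
  have inside: "?g e \<le> 1" if e: "e \<in> edges H" for e
  proof -
    have "?g e \<le> (\<Sum>v\<in>ends H e. f e v)"
      using e assms(1,2) finite_subset[OF _ fin(2)]
      by (intro sum_mono2) (auto simp: multi_hypergraph_def dual_feasible_def)
    then show ?thesis
      using e assms(2) by (simp add: dual_feasible_def)
  qed
  have "(\<Sum>v\<in>?U. l v) = (\<Sum>e\<in>edges H. ?g e)"
    by (rule sum_load_eq[OF assms(1,2) level_set_subset])
  also have "\<dots> = (\<Sum>e\<in>induced_edges H ?W. ?g e)"
    using fin outside by (intro sum.mono_neutral_right) (auto simp: induced_edges_def)
  also have "\<dots> \<le> (\<Sum>e\<in>induced_edges H ?W. 1)"
    using inside by (intro sum_mono) (auto simp: induced_edges_def)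
  finally show ?thesis by simp
qed

lemma level_set_expansion:
  assumes "multi_hypergraph H" and "dual_feasible H \<eta> f l" and "\<eta> \<ge> 0"
  shows "a * real (card (level_set H l a)) \<le> max_density H * real (card (level_set H l (a - \<eta>)))"
proof -
  have "a * real (card (level_set H l a)) \<le> (\<Sum>v\<in>level_set H l a. l v)"
    by (subst mult.commute, rule sum_bounded_below) (simp add: level_set_def)
  also have "\<dots> \<le> real (card (induced_edges H (level_set H l (a - \<eta>))))"
    by (rule sum_load_level_set_le[OF assms])
  also have "\<dots> \<le> max_density H * real (card (level_set H l (a - \<eta>)))"
    by (rule card_induced_edges_le_max_density[OF assms(1) level_set_subset])
  finally show ?thesis .
qed

text \<open>With \<open>y = x / 2\<close>, combine \<open>1 - 2 * y \<le> (1 - y)\<^sup>2\<close>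
  and \<open>1 - y \<le> exp (- y)\<close>. This bounds the growth ratio
  \<open>(1 - \<epsilon> / 2) / (1 - \<epsilon>)\<close> below by
  \<open>exp (\<epsilon> / 2)\<close>.\<close>

lemma one_minus_times_exp_half_le:
  fixes x :: real
  assumes "x \<le> 2"
  shows "(1 - x) * exp (x / 2) \<le> 1 - x / 2"
proof -
  define y where "y = x / 2"
  have y: "x = 2 * y" "0 \<le> 1 - y"
    using assms by (simp_all add: y_def)
  have "1 + - y \<le> exp (- y)"
    by (rule exp_ge_add_one_self)
  then have "(1 - y) * exp y \<le> exp (- y) * exp y"
    by (intro mult_right_mono) auto
  also have "\<dots> = 1"
    by (simp add: exp_minus)
  finally have le_1: "(1 - y) * exp y \<le> 1" .
  have "1 - 2 * y \<le> (1 - y) * (1 - y)"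
    by (simp add: algebra_simps)
  then have "(1 - 2 * y) * exp y \<le> (1 - y) * (1 - y) * exp y"
    by (rule mult_right_mono) simp
  also have "\<dots> = (1 - y) * ((1 - y) * exp y)"
    by (rule mult.assoc)
  also have "\<dots> \<le> (1 - y) * 1"
    by (rule mult_left_mono[OF le_1 y(2)])
  finally show ?thesis
    by (simp add: y(1))
qed

text \<open>Induction on \<open>k\<close>, starting from the vertex of maximum load. The step from
  \<open>i\<close> to \<open>i + 1\<close> uses only the threshold at \<open>i\<close>, so the bound
  on \<open>i * \<eta>\<close> is required just for \<open>i < k\<close>.\<close>

lemma level_set_exp_growth:
  assumes "multi_hypergraph H" and "dual_feasible H \<eta> f l" and "\<eta> \<ge> 0"
    and "v \<in> verts H" and "l v = D" and "D > 0" and "0 < \<epsilon>" and "\<epsilon> < 1"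
    and "max_density H \<le> D * (1 - \<epsilon>)"
    and "\<And>i. i < k \<Longrightarrow> real i * \<eta> \<le> \<epsilon> * D / 2"
  shows "exp (real k * \<epsilon> / 2) \<le> real (card (level_set H l (D - real k * \<eta>)))"
  using assms(10)
proof (induction k)
  case 0
  have "finite (level_set H l D)"
    using assms(1) by (simp add: multi_hypergraph_def level_set_def)
  moreover have "v \<in> level_set H l D"
    using assms(4,5) by (simp add: level_set_def)
  ultimately have "card (level_set H l D) > 0"
    by (auto simp: card_gt_0_iff)
  then show ?case by simp
next
  case (Suc k)
  let ?c = "\<lambda>k. real (card (level_set H l (D - real k * \<eta>)))"
  let ?q = "exp (\<epsilon> / 2)"
  have IH: "exp (real k * \<epsilon> / 2) \<le> ?c k"
    using Suc by simp
  have "D * (1 - \<epsilon>) * (?q * ?c k) = D * ((1 - \<epsilon>) * ?q) * ?c k"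
    by (simp add: mult_ac)
  also have "\<dots> \<le> D * (1 - \<epsilon> / 2) * ?c k"
    using one_minus_times_exp_half_le[of \<epsilon>] assms(6-8)
    by (intro mult_right_mono mult_left_mono) auto
  \<comment> \<open>The threshold is still at least \<open>D * (1 - \<epsilon> / 2)\<close>.\<close>
  also have "\<dots> \<le> (D - real k * \<eta>) * ?c k"
    using Suc.prems[of k] by (intro mult_right_mono) (auto simp: algebra_simps)
  also have "\<dots> \<le> max_density H * ?c (Suc k)"
    using level_set_expansion[OF assms(1-3), of "D - real k * \<eta>"]
    by (simp add: algebra_simps)
  also have "\<dots> \<le> D * (1 - \<epsilon>) * ?c (Suc k)"
    using assms(9) by (intro mult_right_mono) auto
  \<comment> \<open>The common factor \<open>D * (1 - \<epsilon>)\<close> is positive and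
    cancels.\<close>
  finally have "?q * ?c k \<le> ?c (Suc k)"
    using assms(6,8) by simp
  moreover have "exp (real (Suc k) * \<epsilon> / 2) = ?q * exp (real k * \<epsilon> / 2)"
    by (simp add: field_simps flip: exp_add)
  moreover have "?q * exp (real k * \<epsilon> / 2) \<le> ?q * ?c k"
    using IH by simp
  ultimately show ?case by linarith
qed

section \<open>The two bounds\<close>

theorem theorem4:
  fixes H :: "('v, 'e) hypergraph"
    and f :: "'e \<Rightarrow> 'v \<Rightarrow> real"
    and l :: "'v \<Rightarrow> real"
    and \<eta> D \<epsilon> :: real
  assumes "multi_hypergraph H"
    and "card (verts H) \<ge> 2"
    and "edges H \<noteq> {}"
    and "\<eta> > 0"
    and "dual_feasible H \<eta> f l"
    and "D = Max (l ` verts H)"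
    and "\<epsilon> = sqrt (8 * \<eta> * ln (real (card (verts H))) / D)"
    and "\<epsilon> \<le> 1"
  shows "max_density H * (1 - \<epsilon>) \<le> D * (1 - \<epsilon>) \<and> D * (1 - \<epsilon>) < max_density H"
proof
  let ?n = "real (card (verts H))"
  have fin: "finite (verts H)"
    using assms(1) by (simp add: multi_hypergraph_def)
  have ne: "verts H \<noteq> {}"
    using assms(2) by auto
  have le_D: "l v \<le> D" if "v \<in> verts H" for v
    using that fin assms(6) by simp
  have "max_density H \<le> D"
  proof (rule max_density_le[OF assms(1) ne])
    fix U assume U: "U \<subseteq> verts H"
    have "real (card (induced_edges H U)) \<le> (\<Sum>v\<in>U. l v)"
      by (rule card_induced_edges_le_sum_load[OF assms(1,5) U])
    also have "\<dots> \<le> D * real (card U)"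
      by (subst mult.commute, rule sum_bounded_above) (use le_D U in auto)
    finally show "real (card (induced_edges H U)) \<le> D * real (card U)" .
  qed
  then show "max_density H * (1 - \<epsilon>) \<le> D * (1 - \<epsilon>)"
    using assms(8) by (intro mult_right_mono) auto
  have pos: "max_density H > 0"
    by (rule max_density_pos[OF assms(1,3)])
  \<comment> \<open>Positivity of \<open>D\<close> makes the radicand of \<open>\<epsilon>\<close>
    positive, so squaring undoes the root.\<close>
  with \<open>max_density H \<le> D\<close> have "D > 0" by linarith
  have ln_pos: "ln ?n > 0"
    using assms(2) by simp
  have "\<epsilon> > 0"
    using assms(4,7) ln_pos \<open>D > 0\<close> by simp
  have "\<epsilon>\<^sup>2 = 8 * \<eta> * ln ?n / D"
    using assms(4,7) ln_pos \<open>D > 0\<close> by simp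
  then have eps_D: "\<epsilon> * (\<epsilon> * D) = 8 * \<eta> * ln ?n"
    using \<open>D > 0\<close> by (simp add: field_simps power2_eq_square)
  show "D * (1 - \<epsilon>) < max_density H"
  proof (rule ccontr)
    assume "\<not> D * (1 - \<epsilon>) < max_density H"
    then have small: "max_density H \<le> D * (1 - \<epsilon>)" by simp
    \<comment> \<open>Positive density rules out the boundary case
      \<open>\<epsilon> = 1\<close>.\<close>
    with pos have "0 < D * (1 - \<epsilon>)" by linarith
    then have "\<epsilon> < 1"
      using \<open>D > 0\<close> by (simp add: zero_less_mult_iff)
    \<comment> \<open>The least natural number above \<open>\<epsilon> * D / (2 * \<eta>)\<close>:
      each \<open>i < k\<close> still permits a growth step, yet \<open>k\<close> is large enough to
      overshoot \<open>n\<close>.\<close>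
    define k where "k = Suc (nat \<lfloor>\<epsilon> * D / (2 * \<eta>)\<rfloor>)"
    have q_nonneg: "0 \<le> \<epsilon> * D / (2 * \<eta>)"
      using \<open>\<epsilon> > 0\<close> \<open>D > 0\<close> assms(4) by simp
    have steps: "real i * \<eta> \<le> \<epsilon> * D / 2" if "i < k" for i
    proof -
      have "real i \<le> \<epsilon> * D / (2 * \<eta>)"
        using that q_nonneg unfolding k_def by linarith
      then show ?thesis
        using assms(4) by (simp add: field_simps)
    qed
    have "D \<in> l ` verts H"
      unfolding assms(6) using fin ne by (intro Max_in) auto
    then obtain v where v: "v \<in> verts H" "l v = D" by blast
    have "\<epsilon> * D / (2 * \<eta>) < real k"
      using q_nonneg unfolding k_def by linarith
    then have "\<epsilon> * (\<epsilon> * D / (2 * \<eta>)) < \<epsilon> * real k"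
      using \<open>\<epsilon> > 0\<close> by (rule mult_strict_left_mono)
    moreover have "\<epsilon> * (\<epsilon> * D / (2 * \<eta>)) = 4 * ln ?n"
      using eps_D assms(4) by (simp add: field_simps)
    \<comment> \<open>The exponent even exceeds \<open>2 * ln ?n\<close>, which is more than
      \<open>ln ?n\<close> by \<open>ln_pos\<close>.\<close>
    ultimately have "ln ?n < real k * \<epsilon> / 2"
      using ln_pos by (simp add: mult.commute)
    then have "exp (ln ?n) < exp (real k * \<epsilon> / 2)"
      by simp
    moreover have "exp (ln ?n) = ?n"
      using assms(2) by simp
    moreover have "exp (real k * \<epsilon> / 2) \<le> real (card (level_set H l (D - real k * \<eta>)))"
      by (rule level_set_exp_growth[OF assms(1,5) _ v \<open>D > 0\<close> \<open>\<epsilon> > 0\<close> \<open>\<epsilon> < 1\<close> small steps])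
         (use assms(4) in auto)
    moreover have "card (level_set H l (D - real k * \<eta>)) \<le> card (verts H)"
      by (rule card_mono[OF fin level_set_subset])
    ultimately show False by linarith
  qed
qed

end
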